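(* The set of closed terms $t\in\mathrm{Tm}(\mathsf{Untyped})$ whose associated closed untyped $\lambda$-term is affine is $\mathbf{FinSet}$-recognizable: there exist a finite set $Q$ and a subset $F\subseteq[\![\mathsf{Untyped}]\!]_Q$ such that this set equals $\{t\in\mathrm{Tm}(\mathsf{Untyped})\mid[\![t]\!]_Q\in F\}$.
   Context: Simple types: $A ::= o \mid A\to B \mid A\times B \mid 1$; $\mathrm{Tm}(A)$ is the set of closed simply typed $\lambda$-terms of type $A$ modulo $\beta\eta$; for a finite set $Q$, $[\![A]\!]_Q$ and $[\![t]\!]_Q$ are the standard set-theoretic interpretations with $[\![o]\!]_Q = Q$. Let $\mathsf{Untyped}:=((o\to o)\to o)\to(o\to o\to o)\to o$. Untyped terms with de Bruijn indices are $u,v ::= \underline{i}\ (i\ge 1)\mid \mathsf{abs}(u)\mid \mathsf{app}(u,v)$; a scoped term $n\vdash u$ is derivable by: $n\vdash\underline{i}$ if $1\le i\le n$; $n\vdash\mathsf{abs}(u)$ if $n+1\vdash u$; $n\vdash\mathsf{app}(u,v)$ if $n\vdash u$ and $n\vdash v$. A closed untyped term is a $u$ with $0\vdash u$. With variables $\ell:(o\to o)\to o$, $a:o\to o\to o$, $x_1,x_2,\dots:o$, encode $\langle n\vdash\underline{i}\rangle := x_{n+1-i}$, $\langle n\vdash\mathsf{abs}(u)\rangle:=\ell\,(\lambda(x_{n+1}:o).\,\langle n+1\vdash u\rangle)$, $\langle n\vdash\mathsf{app}(u,v)\rangle:=a\,\langle n\vdash u\rangle\,\langle n\vdash v\rangle$;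 the map $u\mapsto\lambda\ell.\lambda a.\langle 0\vdash u\rangle$ is a bijection from closed untyped terms onto $\mathrm{Tm}(\mathsf{Untyped})$, giving the closed untyped term associated with each $t\in\mathrm{Tm}(\mathsf{Untyped})$. For $n\vdash u$ and $1\le i\le n$, $\mathrm{occ}_i$ counts occurrences of the $i$-th variable: $\mathrm{occ}_i(n\vdash\underline{j})$ is $1$ if $i=j$ else $0$; $\mathrm{occ}_i(n\vdash\mathsf{abs}(u)) = \mathrm{occ}_{i+1}(n+1\vdash u)$; $\mathrm{occ}_i(n\vdash\mathsf{app}(u,v))=\mathrm{occ}_i(n\vdash u)+\mathrm{occ}_i(n\vdash v)$. A scoped term is affine in its bound variables: always for $\underline{i}$; for $\mathsf{abs}(u)$ iff $\mathrm{occ}_1(n+1\vdash u)\le 1$ and $n+1\vdash u$ is affine in its bound variables; for $\mathsf{app}(u,v)$ iff both $n\vdash u$ and $n\vdash v$ are. A closed untyped term $u$ is affine iff $0\vdash u$ is affine in its bound variables (i.e. every bound variable occurs at most once). *)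

theory Defs
  imports Main "HOL-Library.FSet" "HOL-Library.FuncSet"
begin

section \<open>Simply typed terms modulo beta-eta\<close>

datatype ty = Base | Fun ty ty (infixr \<open>\<rightarrow>\<^sub>t\<close> 65) | Prod ty ty (infixr \<open>\<times>\<^sub>t\<close> 70) | One

text \<open>Church-style terms with de Bruijn indices counted from 0.\<close>

datatype tm =
    Var nat
  | Lam ty tm
  | App tm tm
  | Tuple tm tm
  | Proj1 tm
  | Proj2 tm
  | Star

inductive typing :: "ty list \<Rightarrow> tm \<Rightarrow> ty \<Rightarrow> bool" (\<open>_ \<turnstile> _ : _\<close> [60, 60, 60] 60) where
  "i < length \<Gamma> \<Longrightarrow> \<Gamma> \<turnstile> Var i : \<Gamma> ! i"
| "A # \<Gamma> \<turnstile> t : B \<Longrightarrow> \<Gamma> \<turnstile> Lam A t : A \<rightarrow>\<^sub>t B"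
| "\<Gamma> \<turnstile> t : A \<rightarrow>\<^sub>t B \<Longrightarrow> \<Gamma> \<turnstile> s : A \<Longrightarrow> \<Gamma> \<turnstile> App t s : B"
| "\<Gamma> \<turnstile> t : A \<Longrightarrow> \<Gamma> \<turnstile> s : B \<Longrightarrow> \<Gamma> \<turnstile> Tuple t s : A \<times>\<^sub>t B"
| "\<Gamma> \<turnstile> t : A \<times>\<^sub>t B \<Longrightarrow> \<Gamma> \<turnstile> Proj1 t : A"
| "\<Gamma> \<turnstile> t : A \<times>\<^sub>t B \<Longrightarrow> \<Gamma> \<turnstile> Proj2 t : B"
| "\<Gamma> \<turnstile> Star : One"

primrec rename :: "(nat \<Rightarrow> nat) \<Rightarrow> tm \<Rightarrow> tm" where
  "rename r (Var i) = Var (r i)"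
| "rename r (Lam A t) = Lam A (rename (case_nat 0 (\<lambda>i. Suc (r i))) t)"
| "rename r (App t s) = App (rename r t) (rename r s)"
| "rename r (Tuple t s) = Tuple (rename r t) (rename r s)"
| "rename r (Proj1 t) = Proj1 (rename r t)"
| "rename r (Proj2 t) = Proj2 (rename r t)"
| "rename r Star = Star"

primrec subst :: "(nat \<Rightarrow> tm) \<Rightarrow> tm \<Rightarrow> tm" where
  "subst \<sigma> (Var i) = \<sigma> i"
| "subst \<sigma> (Lam A t) = Lam A (subst (case_nat (Var 0) (\<lambda>i. rename Suc (\<sigma> i))) t)"
| "subst \<sigma> (App t s) = App (subst \<sigma> t) (subst \<sigma> s)"
| "subst \<sigma> (Tuple t s) = Tuple (subst \<sigma> t) (subst \<sigma> s)"
| "subst \<sigma> (Proj1 t) = Proj1 (subst \<sigma> t)"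
| "subst \<sigma> (Proj2 t) = Proj2 (subst \<sigma> t)"
| "subst \<sigma> Star = Star"

inductive beta_eta :: "ty list \<Rightarrow> tm \<Rightarrow> tm \<Rightarrow> ty \<Rightarrow> bool" (\<open>_ \<turnstile> _ \<approx> _ : _\<close> [60, 60, 60, 60] 60) where
  refl: "\<Gamma> \<turnstile> t : A \<Longrightarrow> \<Gamma> \<turnstile> t \<approx> t : A"
| sym: "\<Gamma> \<turnstile> s \<approx> t : A \<Longrightarrow> \<Gamma> \<turnstile> t \<approx> s : A"
| trans: "\<Gamma> \<turnstile> s \<approx> t : A \<Longrightarrow> \<Gamma> \<turnstile> t \<approx> u : A \<Longrightarrow> \<Gamma> \<turnstile> s \<approx> u : A"
| cong_Lam: "A # \<Gamma> \<turnstile> t \<approx> t' : B \<Longrightarrow> \<Gamma> \<turnstile> Lam A t \<approx> Lam A t' : A \<rightarrow>\<^sub>t B"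
| cong_App: "\<Gamma> \<turnstile> t \<approx> t' : A \<rightarrow>\<^sub>t B \<Longrightarrow> \<Gamma> \<turnstile> s \<approx> s' : A \<Longrightarrow> \<Gamma> \<turnstile> App t s \<approx> App t' s' : B"
| cong_Tuple: "\<Gamma> \<turnstile> t \<approx> t' : A \<Longrightarrow> \<Gamma> \<turnstile> s \<approx> s' : B \<Longrightarrow> \<Gamma> \<turnstile> Tuple t s \<approx> Tuple t' s' : A \<times>\<^sub>t B"
| cong_Proj1: "\<Gamma> \<turnstile> t \<approx> t' : A \<times>\<^sub>t B \<Longrightarrow> \<Gamma> \<turnstile> Proj1 t \<approx> Proj1 t' : A"
| cong_Proj2: "\<Gamma> \<turnstile> t \<approx> t' : A \<times>\<^sub>t B \<Longrightarrow> \<Gamma> \<turnstile> Proj2 t \<approx> Proj2 t' : B"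
| beta_Fun: "A # \<Gamma> \<turnstile> t : B \<Longrightarrow> \<Gamma> \<turnstile> s : A \<Longrightarrow> \<Gamma> \<turnstile> App (Lam A t) s \<approx> subst (case_nat s Var) t : B"
| beta_Proj1: "\<Gamma> \<turnstile> t : A \<Longrightarrow> \<Gamma> \<turnstile> s : B \<Longrightarrow> \<Gamma> \<turnstile> Proj1 (Tuple t s) \<approx> t : A"
| beta_Proj2: "\<Gamma> \<turnstile> t : A \<Longrightarrow> \<Gamma> \<turnstile> s : B \<Longrightarrow> \<Gamma> \<turnstile> Proj2 (Tuple t s) \<approx> s : B"
| eta_Fun: "\<Gamma> \<turnstile> t : A \<rightarrow>\<^sub>t B \<Longrightarrow> \<Gamma> \<turnstile> Lam A (App (rename Suc t) (Var 0)) \<approx> t : A \<rightarrow>\<^sub>t B"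
| eta_Prod: "\<Gamma> \<turnstile> t : A \<times>\<^sub>t B \<Longrightarrow> \<Gamma> \<turnstile> Tuple (Proj1 t) (Proj2 t) \<approx> t : A \<times>\<^sub>t B"
| eta_One: "\<Gamma> \<turnstile> t : One \<Longrightarrow> \<Gamma> \<turnstile> t \<approx> Star : One"

definition beta_eta_rel :: "ty \<Rightarrow> (tm \<times> tm) set" where
  "beta_eta_rel A = {(s, t). [] \<turnstile> s \<approx> t : A}"

definition Tm :: "ty \<Rightarrow> tm set set" where
  "Tm A = {t. [] \<turnstile> t : A} // beta_eta_rel A"

section \<open>Set-theoretic interpretation\<close>

text \<open>
  A single type of values housing all the sets \<open>den Q A\<close>; a function is represented by its
  graph. Since \<open>vgraph\<close> uses \<^const>\<open>Abs_fset\<close>, it is meaningful only on finite domains,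
  so \<open>den\<close> and \<open>sem\<close> are to be used with finite \<open>Q\<close> only.
\<close>

datatype 'q val =
    VBase 'q
  | VFun "('q val \<times> 'q val) fset"
  | VPair "'q val" "'q val"
  | VStar

definition vgraph :: "'q val set \<Rightarrow> ('q val \<Rightarrow> 'q val) \<Rightarrow> 'q val" where
  "vgraph D f = VFun (Abs_fset ((\<lambda>x. (x, f x)) ` D))"

primrec den :: "'q set \<Rightarrow> ty \<Rightarrow> 'q val set" where
  "den Q Base = VBase ` Q"
| "den Q (A \<rightarrow>\<^sub>t B) = vgraph (den Q A) ` (den Q A \<rightarrow>\<^sub>E den Q B)"
| "den Q (A \<times>\<^sub>t B) = {VPair x y | x y. x \<in> den Q A \<and> y \<in> den Q B}"
| "den Q One = {VStar}"

fun vapp :: "'q val \<Rightarrow> 'q val \<Rightarrow> 'q val" where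
  "vapp (VFun G) x = (THE y. (x, y) |\<in>| G)"
| "vapp _ x = undefined"

fun vfst :: "'q val \<Rightarrow> 'q val" where
  "vfst (VPair x y) = x"
| "vfst _ = undefined"

fun vsnd :: "'q val \<Rightarrow> 'q val" where
  "vsnd (VPair x y) = y"
| "vsnd _ = undefined"

primrec sem :: "'q set \<Rightarrow> tm \<Rightarrow> 'q val list \<Rightarrow> 'q val" where
  "sem Q (Var i) \<rho> = \<rho> ! i"
| "sem Q (Lam A t) \<rho> = vgraph (den Q A) (\<lambda>x. sem Q t (x # \<rho>))"
| "sem Q (App t s) \<rho> = vapp (sem Q t \<rho>) (sem Q s \<rho>)"
| "sem Q (Tuple t s) \<rho> = VPair (sem Q t \<rho>) (sem Q s \<rho>)"
| "sem Q (Proj1 t) \<rho> = vfst (sem Q t \<rho>)"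
| "sem Q (Proj2 t) \<rho> = vsnd (sem Q t \<rho>)"
| "sem Q Star \<rho> = VStar"

text \<open>The common interpretation of all members of a \<open>\<beta>\<eta>\<close>-class of closed terms.\<close>

definition sem_class :: "'q set \<Rightarrow> tm set \<Rightarrow> 'q val" where
  "sem_class Q c = the_elem ((\<lambda>t. sem Q t []) ` c)"

text \<open>
  Taking \<open>Q\<close> to be a set of natural numbers is no restriction: every finite set is in bijection
  with one, and the interpretation is invariant under renaming the elements of \<open>Q\<close>.
\<close>

definition FinSet_recognizable :: "ty \<Rightarrow> tm set set \<Rightarrow> bool" where
  "FinSet_recognizable A L \<longleftrightarrow>
     (\<exists>(Q :: nat set) F. finite Q \<and> F \<subseteq> den Q A \<and> L = {t \<in> Tm A. sem_class Q t \<in> F})"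

section \<open>Untyped terms\<close>

definition Untyped :: ty where
  "Untyped = ((Base \<rightarrow>\<^sub>t Base) \<rightarrow>\<^sub>t Base) \<rightarrow>\<^sub>t (Base \<rightarrow>\<^sub>t Base \<rightarrow>\<^sub>t Base) \<rightarrow>\<^sub>t Base"

text \<open>Here de Bruijn indices are counted from 1; \<open>scoped\<close> excludes the index 0.\<close>

datatype utm = Idx nat | Abs utm | Ap utm utm

inductive scoped :: "nat \<Rightarrow> utm \<Rightarrow> bool" where
  "1 \<le> i \<Longrightarrow> i \<le> n \<Longrightarrow> scoped n (Idx i)"
| "scoped (n + 1) u \<Longrightarrow> scoped n (Abs u)"
| "scoped n u \<Longrightarrow> scoped n v \<Longrightarrow> scoped n (Ap u v)"

text \<open>
  The term \<open>enc n u\<close> is typed in the context listing, from index 0 upwards,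
  \<open>x\<^sub>n, \<dots>, x\<^sub>1, a, \<ell>\<close>. So \<open>x\<^sub>k\<close> is \<open>Var (n - k)\<close>, whence \<open>x\<^sub>n\<^sub>+\<^sub>1\<^sub>-\<^sub>i\<close> is \<open>Var (i - 1)\<close>,
  while \<open>a\<close> is \<open>Var n\<close> and \<open>\<ell>\<close> is \<open>Var (n + 1)\<close>.
\<close>

primrec enc :: "nat \<Rightarrow> utm \<Rightarrow> tm" where
  "enc n (Idx i) = Var (i - 1)"
| "enc n (Abs u) = App (Var (n + 1)) (Lam Base (enc (n + 1) u))"
| "enc n (Ap u v) = App (App (Var n) (enc n u)) (enc n v)"

definition encode :: "utm \<Rightarrow> tm set" where
  "encode u = beta_eta_rel Untyped ``
     {Lam ((Base \<rightarrow>\<^sub>t Base) \<rightarrow>\<^sub>t Base) (Lam (Base \<rightarrow>\<^sub>t Base \<rightarrow>\<^sub>t Base) (enc 0 u))}"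

text \<open>Inverse of the bijection \<open>encode\<close> from closed untyped terms onto \<open>Tm Untyped\<close>.\<close>

definition untyped_of :: "tm set \<Rightarrow> utm" where
  "untyped_of = inv_into {u. scoped 0 u} encode"

text \<open>The scope \<open>n\<close> plays no role in counting occurrences or in affineness, and is omitted.\<close>

primrec occ :: "nat \<Rightarrow> utm \<Rightarrow> nat" where
  "occ i (Idx j) = (if i = j then 1 else 0)"
| "occ i (Abs u) = occ (i + 1) u"
| "occ i (Ap u v) = occ i u + occ i v"

primrec affine :: "utm \<Rightarrow> bool" where
  "affine (Idx i) \<longleftrightarrow> True"
| "affine (Abs u) \<longleftrightarrow> occ 1 u \<le> 1 \<and> affine u"
| "affine (Ap u v) \<longleftrightarrow> affine u \<and> affine v"

end

theory Submission imports Defs begin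

text \<open>
  Over \<open>Q = {0, 1, 2}\<close>, interpret \<open>a\<close> as addition capped at 2 and \<open>\<ell>\<close> as the map sending \<open>f\<close> to
  \<open>f 0\<close> if \<open>f 0 \<noteq> 0\<close>, and otherwise to 2 or 0 according to whether \<open>f 1 = 2\<close>. If the free variables
  of an affine term are given values in \<open>{0, 1}\<close>, then the term evaluates to the capped number of
  occurrences of those with value 1: inside an abstraction, the body is probed with a marked
  variable only when no outer marked variable occurs. Hence, when all free variables have value 0,
  a term evaluates to 0 if it is affine, and to 2 otherwise.

  That every class in \<open>Tm Untyped\<close> is the encoding of some closed untyped term follows from a Kripke
  logical predicate whose worlds are the contexts \<open>x\<^sub>n, \<dots>, x\<^sub>1, a, \<ell>\<close> and which at base type says
  \<open>\<beta>\<eta>\<close>-equal to an encoding. Two untyped terms with the same encoding have the same value in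
  the model, so it does not matter which preimage \<open>untyped_of\<close> picks.
\<close>

section \<open>Renaming and substitution\<close>

lemma rename_rename: "rename r (rename r' t) = rename (\<lambda>i. r (r' i)) t"
proof (induction t arbitrary: r r')
  case (Lam A t)
  have "(\<lambda>i. case_nat 0 (\<lambda>i. Suc (r i)) (case_nat 0 (\<lambda>i. Suc (r' i)) i))
      = case_nat 0 (\<lambda>i. Suc (r (r' i)))"
    by (auto split: nat.split)
  then show ?case using Lam by simp
qed auto

lemma subst_rename: "subst \<sigma> (rename r t) = subst (\<lambda>i. \<sigma> (r i)) t"
proof (induction t arbitrary: r \<sigma>)
  case (Lam A t)
  have "(\<lambda>i. case_nat (Var 0) (\<lambda>i. rename Suc (\<sigma> i)) (case_nat 0 (\<lambda>i. Suc (r i)) i))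
      = case_nat (Var 0) (\<lambda>i. rename Suc (\<sigma> (r i)))"
    by (auto split: nat.split)
  then show ?case using Lam by simp
qed auto

lemma rename_subst: "rename r (subst \<sigma> t) = subst (\<lambda>i. rename r (\<sigma> i)) t"
proof (induction t arbitrary: r \<sigma>)
  case (Lam A t)
  have "(\<lambda>i. rename (case_nat 0 (\<lambda>i. Suc (r i))) (case_nat (Var 0) (\<lambda>i. rename Suc (\<sigma> i)) i))
      = case_nat (Var 0) (\<lambda>i. rename Suc (rename r (\<sigma> i)))"
    by (auto split: nat.split simp: rename_rename)
  then show ?case using Lam by simp
qed auto

lemma subst_subst: "subst \<tau> (subst \<sigma> t) = subst (\<lambda>i. subst \<tau> (\<sigma> i)) t"
proof (induction t arbitrary: \<tau> \<sigma>)
  case (Lam A t)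
  have "(\<lambda>i. subst (case_nat (Var 0) (\<lambda>i. rename Suc (\<tau> i)))
        (case_nat (Var 0) (\<lambda>i. rename Suc (\<sigma> i)) i))
      = case_nat (Var 0) (\<lambda>i. rename Suc (subst \<tau> (\<sigma> i)))"
    by (auto split: nat.split simp: subst_rename rename_subst)
  then show ?case using Lam by simp
qed auto

lemma subst_Var_comp: "subst (\<lambda>i. Var (r i)) t = rename r t"
proof (induction t arbitrary: r)
  case (Lam A t)
  have "case_nat (Var 0) (\<lambda>i. rename Suc (Var (r i)))
      = (\<lambda>i. Var (case_nat 0 (\<lambda>i. Suc (r i)) i))"
    by (auto split: nat.split)
  then show ?case using Lam by simp
qed auto

lemma subst_Var: "subst Var t = t"
proof (induction t)
  case (Lam A t)
  have "case_nat (Var 0) (\<lambda>i. rename Suc (Var i)) = Var"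
    by (auto split: nat.split)
  then show ?case using Lam by simp
qed auto

lemma rename_plus_0: "rename ((+) 0) t = t"
  using subst_Var_comp[of "(+) 0" t] subst_Var[of t] by simp

text \<open>Serves the beta rule in \<open>beta_eta_rename\<close>. Both sides become the same
  single substitution once composites are fused.\<close>

lemma rename_beta:
  "rename r (subst (case_nat s Var) t)
     = subst (case_nat (rename r s) Var) (rename (case_nat 0 (\<lambda>i. Suc (r i))) t)"
proof -
  have "(\<lambda>i. rename r (case_nat s Var i))
      = (\<lambda>i. case_nat (rename r s) Var (case_nat 0 (\<lambda>i. Suc (r i)) i))"
    by (auto split: nat.split)
  then show ?thesis by (simp add: rename_subst subst_rename)
qed

text \<open>The left side is what beta produces from a substituted and then renamed abstraction.
  Fusing it into one substitution brings it to the form of the induction hypothesis in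
  \<open>encodable_subst\<close>.\<close>

lemma beta_rename_subst:
  "subst (case_nat s Var)
     (rename (case_nat 0 (\<lambda>i. Suc (r i))) (subst (case_nat (Var 0) (\<lambda>i. rename Suc (\<sigma> i))) t))
     = subst (case_nat s (\<lambda>i. rename r (\<sigma> i))) t"
proof -
  have "(\<lambda>i. subst (\<lambda>j. case_nat s Var (case_nat 0 (\<lambda>i. Suc (r i)) j))
        (case_nat (Var 0) (\<lambda>i. rename Suc (\<sigma> i)) i))
      = case_nat s (\<lambda>i. rename r (\<sigma> i))"
    by (auto split: nat.split simp: subst_rename subst_Var_comp)
  then show ?thesis by (simp add: subst_rename subst_subst)
qed

section \<open>Typing\<close>

lemma typing_Var: "i < length \<Gamma> \<Longrightarrow> \<Gamma> ! i = A \<Longrightarrow> \<Gamma> \<turnstile> Var i : A"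
  using typing.intros(1) by blast

lemma typing_rename:
  assumes "\<Gamma> \<turnstile> t : A" and "\<And>i. i < length \<Gamma> \<Longrightarrow> r i < length \<Delta> \<and> \<Delta> ! r i = \<Gamma> ! i"
  shows "\<Delta> \<turnstile> rename r t : A"
  using assms
proof (induction arbitrary: \<Delta> r rule: typing.induct)
  case (1 i \<Gamma>)
  then show ?case by (auto intro: typing_Var)
next
  case (2 A \<Gamma> t B)
  have "A # \<Delta> \<turnstile> rename (case_nat 0 (\<lambda>i. Suc (r i))) t : B"
    by (rule "2.IH") (use "2.prems" in \<open>auto split: nat.split\<close>)
  then show ?case by (auto intro: typing.intros)
next
  case (3 \<Gamma> t A B s)
  have "\<Delta> \<turnstile> rename r t : A \<rightarrow>\<^sub>t B" "\<Delta> \<turnstile> rename r s : A"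
    using 3 by blast+
  then show ?case by (auto intro: typing.intros)
qed (auto intro: typing.intros)

lemma typing_rename_Suc: "\<Gamma> \<turnstile> t : A \<Longrightarrow> B # \<Gamma> \<turnstile> rename Suc t : A"
  by (rule typing_rename) auto

lemma typing_subst:
  assumes "\<Gamma> \<turnstile> t : A" and "\<And>i. i < length \<Gamma> \<Longrightarrow> \<Delta> \<turnstile> \<sigma> i : \<Gamma> ! i"
  shows "\<Delta> \<turnstile> subst \<sigma> t : A"
  using assms
proof (induction arbitrary: \<Delta> \<sigma> rule: typing.induct)
  case (2 A \<Gamma> t B)
  have "A # \<Delta> \<turnstile> subst (case_nat (Var 0) (\<lambda>i. rename Suc (\<sigma> i))) t : B"
    by (rule "2.IH")
      (use "2.prems" in \<open>auto split: nat.split intro: typing_Var typing_rename_Suc\<close>)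
  then show ?case by (auto intro: typing.intros)
next
  case (3 \<Gamma> t A B s)
  have "\<Delta> \<turnstile> subst \<sigma> t : A \<rightarrow>\<^sub>t B" "\<Delta> \<turnstile> subst \<sigma> s : A"
    using 3 by blast+
  then show ?case by (auto intro: typing.intros)
qed (auto intro: typing.intros)

lemma typing_beta:
  assumes "A # \<Gamma> \<turnstile> t : B" and "\<Gamma> \<turnstile> s : A"
  shows "\<Gamma> \<turnstile> subst (case_nat s Var) t : B"
  by (rule typing_subst[OF assms(1)]) (use assms(2) in \<open>auto split: nat.split intro: typing_Var\<close>)

lemma beta_eta_typing: "\<Gamma> \<turnstile> s \<approx> t : A \<Longrightarrow> \<Gamma> \<turnstile> s : A \<and> \<Gamma> \<turnstile> t : A"
proof (induction rule: beta_eta.induct)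
  case (eta_Fun \<Gamma> t A B)
  then show ?case
    by (auto intro!: typing.intros(2) typing.intros(3)[of _ _ A] typing_rename_Suc typing_Var)
qed (auto intro: typing.intros typing_beta)

lemma beta_eta_rename:
  assumes "\<Gamma> \<turnstile> s \<approx> t : A" and "\<And>i. i < length \<Gamma> \<Longrightarrow> r i < length \<Delta> \<and> \<Delta> ! r i = \<Gamma> ! i"
  shows "\<Delta> \<turnstile> rename r s \<approx> rename r t : A"
  using assms
proof (induction arbitrary: \<Delta> r rule: beta_eta.induct)
  case (cong_Lam A \<Gamma> t t' B)
  have "A # \<Delta> \<turnstile> rename (case_nat 0 (\<lambda>i. Suc (r i))) t \<approx> rename (case_nat 0 (\<lambda>i. Suc (r i))) t' : B"
    by (rule cong_Lam.IH) (use cong_Lam.prems in \<open>auto split: nat.split\<close>)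
  then show ?case by (auto intro: beta_eta.intros)
next
  case (beta_Fun A \<Gamma> t B s)
  have "A # \<Delta> \<turnstile> rename (case_nat 0 (\<lambda>i. Suc (r i))) t : B"
    by (rule typing_rename[OF beta_Fun(1)]) (use beta_Fun.prems in \<open>auto split: nat.split\<close>)
  moreover have "\<Delta> \<turnstile> rename r s : A"
    using beta_Fun by (auto intro: typing_rename)
  ultimately show ?case
    by (simp add: rename_beta beta_eta.beta_Fun)
next
  case (eta_Fun \<Gamma> t A B)
  have "\<Delta> \<turnstile> rename r t : A \<rightarrow>\<^sub>t B"
    using eta_Fun by (auto intro: typing_rename)
  from beta_eta.eta_Fun[OF this] show ?case
    by (simp add: rename_rename)
next
  case (trans \<Gamma> s t A u)
  then show ?case by (blast intro: beta_eta.trans)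
next
  case (refl \<Gamma> t A)
  then show ?case by (blast intro: beta_eta.refl typing_rename)
next
  case (sym \<Gamma> s t A)
  then show ?case by (blast intro: beta_eta.sym)
next
  case (cong_App \<Gamma> t t' A B s s')
  have "\<Delta> \<turnstile> rename r t \<approx> rename r t' : A \<rightarrow>\<^sub>t B" "\<Delta> \<turnstile> rename r s \<approx> rename r s' : A"
    using cong_App by blast+
  then show ?case by (auto intro: beta_eta.cong_App)
next
  case (cong_Tuple \<Gamma> t t' A s s' B)
  have "\<Delta> \<turnstile> rename r t \<approx> rename r t' : A" "\<Delta> \<turnstile> rename r s \<approx> rename r s' : B"
    using cong_Tuple by blast+
  then show ?case by (auto intro: beta_eta.cong_Tuple)
next
  case (cong_Proj1 \<Gamma> t t' A B)
  have "\<Delta> \<turnstile> rename r t \<approx> rename r t' : A \<times>\<^sub>t B" using cong_Proj1 by blast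
  then show ?case by (auto intro: beta_eta.cong_Proj1)
next
  case (cong_Proj2 \<Gamma> t t' A B)
  have "\<Delta> \<turnstile> rename r t \<approx> rename r t' : A \<times>\<^sub>t B" using cong_Proj2 by blast
  then show ?case by (auto intro: beta_eta.cong_Proj2)
next
  case (beta_Proj1 \<Gamma> t A s B)
  have "\<Delta> \<turnstile> rename r t : A" "\<Delta> \<turnstile> rename r s : B"
    using beta_Proj1 by (blast intro: typing_rename)+
  then show ?case by (auto intro: beta_eta.beta_Proj1)
next
  case (beta_Proj2 \<Gamma> t A s B)
  have "\<Delta> \<turnstile> rename r t : A" "\<Delta> \<turnstile> rename r s : B"
    using beta_Proj2 by (blast intro: typing_rename)+
  then show ?case by (auto intro: beta_eta.beta_Proj2)
next
  case (eta_Prod \<Gamma> t A B)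
  have "\<Delta> \<turnstile> rename r t : A \<times>\<^sub>t B" using eta_Prod by (blast intro: typing_rename)
  then show ?case by (auto intro: beta_eta.eta_Prod)
next
  case (eta_One \<Gamma> t)
  have "\<Delta> \<turnstile> rename r t : One" using eta_One by (blast intro: typing_rename)
  then show ?case by (auto intro: beta_eta.eta_One)
qed

section \<open>Surjectivity of the encoding\<close>

abbreviation lam_ty :: ty where
  "lam_ty \<equiv> (Base \<rightarrow>\<^sub>t Base) \<rightarrow>\<^sub>t Base"

abbreviation app_ty :: ty where
  "app_ty \<equiv> Base \<rightarrow>\<^sub>t Base \<rightarrow>\<^sub>t Base"

definition uctx :: "nat \<Rightarrow> ty list" where
  "uctx n = replicate n Base @ [app_ty, lam_ty]"

lemma length_uctx [simp]: "length (uctx n) = n + 2"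
  by (simp add: uctx_def)

lemma nth_uctx:
  "i < n \<Longrightarrow> uctx n ! i = Base" "uctx n ! n = app_ty" "uctx n ! Suc n = lam_ty"
  by (simp_all add: uctx_def nth_append)

lemma uctx_Suc: "uctx (Suc n) = Base # uctx n"
  by (simp add: uctx_def)

text \<open>Since a and \<ell> stand behind the base variables, passing to a larger world is the
  shift \<open>(+) k\<close>. This is the only kind of world extension that the logical predicate
  uses.\<close>

lemma uctx_shift: "i < length (uctx n) \<Longrightarrow> k + i < length (uctx (k + n)) \<and> uctx (k + n) ! (k + i) = uctx n ! i"
  by (auto simp: uctx_def nth_append)

lemma typing_enc: "scoped n u \<Longrightarrow> uctx n \<turnstile> enc n u : Base"
proof (induction rule: scoped.induct)
  case (1 i n)
  then show ?case by (auto intro!: typing_Var simp: nth_uctx)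
next
  case (2 n u)
  then have "uctx n \<turnstile> Lam Base (enc (Suc n) u) : Base \<rightarrow>\<^sub>t Base"
    by (auto intro: typing.intros simp: uctx_Suc)
  moreover have "uctx n \<turnstile> Var (Suc n) : lam_ty"
    by (auto intro!: typing_Var simp: nth_uctx)
  ultimately show ?case by (auto intro: typing.intros)
next
  case (3 n u v)
  have "uctx n \<turnstile> Var n : app_ty"
    by (auto intro!: typing_Var simp: nth_uctx)
  with 3 show ?case by (auto intro: typing.intros)
qed

text \<open>A shift does not stay a shift under a binder, so the induction is over renamings of
  which only the bound on base variables and the positions of a and \<ell> are prescribed.\<close>

lemma rename_enc:
  assumes "scoped n u" and "\<And>i. i < n \<Longrightarrow> r i < k + n" and "r n = k + n" and "r (Suc n) = Suc (k + n)"
  shows "\<exists>v. scoped (k + n) v \<and> rename r (enc n u) = enc (k + n) v"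
  using assms
proof (induction arbitrary: r rule: scoped.induct)
  case (1 i n)
  \<comment> \<open>Indices of \<open>utm\<close> start at 1 and those of \<open>tm\<close> at 0,
    whence the \<open>Suc\<close> around \<open>r (i - 1)\<close>.\<close>
  then have "scoped (k + n) (Idx (Suc (r (i - 1))))"
    by (intro scoped.intros) (auto simp: Suc_le_eq)
  then show ?case by (intro exI[of _ "Idx (Suc (r (i - 1)))"]) simp
next
  case (2 n u)
  have "\<exists>v. scoped (k + (n + 1)) v \<and>
      rename (case_nat 0 (\<lambda>i. Suc (r i))) (enc (n + 1) u) = enc (k + (n + 1)) v"
    by (rule "2.IH") (use "2.prems" in \<open>auto split: nat.split\<close>)
  then obtain v where "scoped (k + n + 1) v"
    "rename (case_nat 0 (\<lambda>i. Suc (r i))) (enc (n + 1) u) = enc (k + n + 1) v"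
    by (auto simp: add.assoc)
  then show ?case using "2.prems"
    by (intro exI[of _ "Abs v"]) (auto intro: scoped.intros)
next
  case (3 n u v)
  then obtain u' v' where "scoped (k + n) u'" "rename r (enc n u) = enc (k + n) u'"
    "scoped (k + n) v'" "rename r (enc n v) = enc (k + n) v'"
    by metis
  then show ?case using "3.prems"
    by (intro exI[of _ "Ap u' v'"]) (auto intro: scoped.intros)
qed

text \<open>Typing is recorded at the non-base types because the rules of \<open>beta_eta\<close>
  are typed; at \<open>Base\<close> it follows from the conversion. The arrow clause ranges over all
  larger worlds so that a function can be tested on a fresh variable.\<close>

primrec encodable :: "ty \<Rightarrow> nat \<Rightarrow> tm \<Rightarrow> bool" where
  "encodable Base n t \<longleftrightarrow> (\<exists>u. scoped n u \<and> uctx n \<turnstile> t \<approx> enc n u : Base)"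
| "encodable (A \<rightarrow>\<^sub>t B) n t \<longleftrightarrow> uctx n \<turnstile> t : A \<rightarrow>\<^sub>t B \<and>
     (\<forall>k s. encodable A (k + n) s \<longrightarrow> encodable B (k + n) (App (rename ((+) k) t) s))"
| "encodable (A \<times>\<^sub>t B) n t \<longleftrightarrow> uctx n \<turnstile> t : A \<times>\<^sub>t B \<and>
     encodable A n (Proj1 t) \<and> encodable B n (Proj2 t)"
| "encodable One n t \<longleftrightarrow> uctx n \<turnstile> t : One"

lemma encodable_typing: "encodable A n t \<Longrightarrow> uctx n \<turnstile> t : A"
  by (cases A) (auto dest: beta_eta_typing)

text \<open>Needed because redexes are only convertible, not equal, to their contracta.\<close>

lemma encodable_cong: "encodable A n t \<Longrightarrow> uctx n \<turnstile> t \<approx> t' : A \<Longrightarrow> encodable A n t'"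
proof (induction A arbitrary: n t t')
  case Base
  then show ?case unfolding encodable.simps by (blast intro: beta_eta.sym beta_eta.trans)
next
  case (Fun A B)
  have "encodable B (k + n) (App (rename ((+) k) t') s)" if s: "encodable A (k + n) s" for k s
  proof (rule Fun.IH(2))
    show "encodable B (k + n) (App (rename ((+) k) t) s)" using Fun.prems s by simp
    have "uctx (k + n) \<turnstile> rename ((+) k) t \<approx> rename ((+) k) t' : A \<rightarrow>\<^sub>t B"
      using Fun.prems(2) uctx_shift by (rule beta_eta_rename)
    then show "uctx (k + n) \<turnstile> App (rename ((+) k) t) s \<approx> App (rename ((+) k) t') s : B"
      using encodable_typing[OF s] by (auto intro: beta_eta.intros)
  qed
  then show ?case using beta_eta_typing[OF Fun.prems(2)] by simp
next
  case (Prod A B)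
  then show ?case
    using beta_eta_typing[OF Prod.prems(2)] Prod.IH(1)[OF _ beta_eta.cong_Proj1[OF Prod.prems(2)]]
      Prod.IH(2)[OF _ beta_eta.cong_Proj2[OF Prod.prems(2)]] by simp
next
  case One
  then show ?case by (auto dest: beta_eta_typing)
qed

text \<open>Kripke monotonicity. At \<open>Base\<close> a shifted encoding is again an encoding, by
  \<open>rename_enc\<close>; at arrow types two successive shifts merge into one.\<close>

lemma encodable_rename: "encodable A n t \<Longrightarrow> encodable A (k + n) (rename ((+) k) t)"
proof (induction A arbitrary: n t)
  case Base
  then obtain u where u: "scoped n u" "uctx n \<turnstile> t \<approx> enc n u : Base" by auto
  obtain v where v: "scoped (k + n) v" "rename ((+) k) (enc n u) = enc (k + n) v"
    using rename_enc[OF u(1), of "(+) k" k] by auto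
  have "uctx (k + n) \<turnstile> rename ((+) k) t \<approx> rename ((+) k) (enc n u) : Base"
    using u(2) uctx_shift by (rule beta_eta_rename)
  with v show ?case by auto
next
  case (Fun A B)
  have "uctx (k + n) \<turnstile> rename ((+) k) t : A \<rightarrow>\<^sub>t B"
    using encodable_typing[OF Fun.prems] uctx_shift by (rule typing_rename)
  moreover have "encodable B (j + (k + n)) (App (rename ((+) j) (rename ((+) k) t)) s)"
    if s: "encodable A (j + (k + n)) s" for j s
  proof -
    have "(\<lambda>i. j + (k + i)) = (+) (j + k)" by (auto simp: add.assoc)
    then show ?thesis using s Fun.prems by (simp add: rename_rename flip: add.assoc)
  qed
  ultimately show ?case by simp
next
  case (Prod A B)
  have "uctx (k + n) \<turnstile> rename ((+) k) t : A \<times>\<^sub>t B"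
    using encodable_typing[OF Prod.prems] uctx_shift by (rule typing_rename)
  then show ?case
    using Prod.IH(1)[of n "Proj1 t"] Prod.IH(2)[of n "Proj2 t"] Prod.prems by simp
next
  case One
  then show ?case using typing_rename[OF _ uctx_shift, of n t One k] by simp
qed

text \<open>Fundamental lemma of the logical predicate. For an abstraction, the argument
  \<open>s\<close> from a larger world is added to the shifted substitution, and the result is
  carried back to the application by beta expansion.\<close>

lemma encodable_subst:
  assumes "\<Gamma> \<turnstile> t : A" and "\<And>i. i < length \<Gamma> \<Longrightarrow> encodable (\<Gamma> ! i) n (\<sigma> i)"
  shows "encodable A n (subst \<sigma> t)"
  using assms
proof (induction arbitrary: n \<sigma> rule: typing.induct)
  case (2 A \<Gamma> t B)
  have ty: "uctx n \<turnstile> subst \<sigma> (Lam A t) : A \<rightarrow>\<^sub>t B"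
    using 2 by (intro typing_subst[of \<Gamma>]) (auto intro: typing.intros encodable_typing)
  have "encodable B (k + n) (App (rename ((+) k) (subst \<sigma> (Lam A t))) s)"
    if s: "encodable A (k + n) s" for k s
  proof (rule encodable_cong)
    show "encodable B (k + n) (subst (case_nat s (\<lambda>i. rename ((+) k) (\<sigma> i))) t)"
      by (rule "2.IH") (use s "2.prems" in \<open>auto split: nat.split intro: encodable_rename\<close>)
    have "uctx (k + n) \<turnstile> rename ((+) k) (subst \<sigma> (Lam A t)) : A \<rightarrow>\<^sub>t B"
      using ty uctx_shift by (rule typing_rename)
    then have "A # uctx (k + n) \<turnstile> rename (case_nat 0 (\<lambda>i. Suc (k + i)))
        (subst (case_nat (Var 0) (\<lambda>i. rename Suc (\<sigma> i))) t) : B"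
      by (auto elim: typing.cases)
    from beta_eta.sym[OF beta_eta.beta_Fun[OF this encodable_typing[OF s]]]
    show "uctx (k + n) \<turnstile> subst (case_nat s (\<lambda>i. rename ((+) k) (\<sigma> i))) t
        \<approx> App (rename ((+) k) (subst \<sigma> (Lam A t))) s : B"
      by (simp add: beta_rename_subst)
  qed
  with ty show ?case by simp
next
  case (3 \<Gamma> t A B s)
  then have "encodable (A \<rightarrow>\<^sub>t B) n (subst \<sigma> t)" "encodable A n (subst \<sigma> s)" by blast+
  \<comment> \<open>The arrow clause is used in the current world, that is, with
    \<open>k = 0\<close>.\<close>
  then have "encodable B (0 + n) (App (rename ((+) 0) (subst \<sigma> t)) (subst \<sigma> s))"
    unfolding encodable.simps by (metis add_0)
  then show ?case by (simp add: rename_plus_0)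
next
  case (4 \<Gamma> t A s B)
  then have *: "encodable A n (subst \<sigma> t)" "encodable B n (subst \<sigma> s)" by blast+
  note ty = this[THEN encodable_typing]
  show ?case
    using ty encodable_cong[OF *(1) beta_eta.sym[OF beta_eta.beta_Proj1[OF ty]]]
      encodable_cong[OF *(2) beta_eta.sym[OF beta_eta.beta_Proj2[OF ty]]]
    by (auto intro: typing.intros)
next
  case (5 \<Gamma> t A B)
  then have "encodable (A \<times>\<^sub>t B) n (subst \<sigma> t)" by blast
  then show ?case by simp
next
  case (6 \<Gamma> t A B)
  then have "encodable (A \<times>\<^sub>t B) n (subst \<sigma> t)" by blast
  then show ?case by simp
qed (auto intro: typing.intros)

text \<open>Both arguments convert to encodings, and \<open>Ap\<close> of the two untyped terms is
  the witness. The first argument is shifted by \<open>j\<close> since the second may arrive in a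
  larger world.\<close>

lemma encodable_app_var: "encodable app_ty n (Var n)"
proof -
  have ty: "uctx m \<turnstile> Var m : app_ty" for m
    by (auto intro!: typing_Var simp: nth_uctx)
  have "encodable Base (j + (k + n)) (App (App (Var (j + (k + n))) (rename ((+) j) s)) s')"
    if s: "encodable Base (k + n) s" and s': "encodable Base (j + (k + n)) s'" for j k s s'
  proof -
    let ?m = "j + (k + n)"
    obtain u v where u: "scoped ?m u" "uctx ?m \<turnstile> rename ((+) j) s \<approx> enc ?m u : Base"
      and v: "scoped ?m v" "uctx ?m \<turnstile> s' \<approx> enc ?m v : Base"
      using encodable_rename[OF s, of j] s' by auto
    then have "uctx ?m \<turnstile> App (App (Var ?m) (rename ((+) j) s)) s' \<approx> enc ?m (Ap u v) : Base"
      using ty[of ?m] by (auto intro: beta_eta.intros)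
    moreover have "scoped ?m (Ap u v)" using u v by (auto intro: scoped.intros)
    ultimately show ?thesis by auto
  qed
  moreover have "uctx (k + n) \<turnstile> App (Var (k + n)) s : Base \<rightarrow>\<^sub>t Base"
    if "encodable Base (k + n) s" for k s
    using ty encodable_typing[OF that] by (auto intro: typing.intros)
  ultimately show ?thesis using ty by (simp del: encodable.simps(1))
qed

text \<open>Testing \<open>f\<close> on a fresh base variable yields the encoding of some
  \<open>u\<close>. By eta, \<open>f\<close> is convertible to the abstraction of that encoding, so
  \<open>Abs u\<close> is the witness.\<close>

lemma encodable_lam_var: "encodable lam_ty n (Var (Suc n))"
proof -
  have ty: "uctx m \<turnstile> Var (Suc m) : lam_ty" for m
    by (auto intro!: typing_Var simp: nth_uctx)
  have "encodable Base m (App (Var (Suc m)) f)" if f: "encodable (Base \<rightarrow>\<^sub>t Base) m f" for m f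
  proof -
    \<comment> \<open>In world \<open>1 + m\<close> the fresh variable is \<open>Var 0\<close>,
      which is the encoding of \<open>Idx 1\<close>.\<close>
    have "scoped (1 + m) (Idx 1)" by (auto intro: scoped.intros)
    moreover from this have "uctx (1 + m) \<turnstile> Var 0 \<approx> enc (1 + m) (Idx 1) : Base"
      using typing_enc[of "1 + m" "Idx 1"] by (auto intro: beta_eta.refl)
    ultimately have "encodable Base (1 + m) (Var 0)" by auto
    then have "encodable Base (1 + m) (App (rename ((+) 1) f) (Var 0))"
      using f unfolding encodable.simps(2) by blast
    then obtain u where u: "scoped (Suc m) u"
      "uctx (Suc m) \<turnstile> App (rename Suc f) (Var 0) \<approx> enc (Suc m) u : Base"
      by (auto simp del: One_nat_def simp: plus_1_eq_Suc)
    from u(2) have "uctx m \<turnstile> Lam Base (App (rename Suc f) (Var 0))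
        \<approx> Lam Base (enc (Suc m) u) : Base \<rightarrow>\<^sub>t Base"
      by (auto intro: beta_eta.cong_Lam simp: uctx_Suc)
    then have "uctx m \<turnstile> f \<approx> Lam Base (enc (Suc m) u) : Base \<rightarrow>\<^sub>t Base"
      using beta_eta.eta_Fun[OF encodable_typing[OF f]] by (blast intro: beta_eta.intros)
    then have "uctx m \<turnstile> App (Var (Suc m)) f \<approx> enc m (Abs u) : Base"
      using ty by (auto intro: beta_eta.intros)
    moreover have "scoped m (Abs u)" using u by (auto intro: scoped.intros)
    ultimately show ?thesis by auto
  qed
  then show ?thesis using ty
    by (simp del: encodable.simps(1,2) add: encodable.simps(2)[of "Base \<rightarrow>\<^sub>t Base"])
qed

section \<open>From the logical predicate back to closed terms\<close>

abbreviation enc_tm :: "utm \<Rightarrow> tm" where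
  "enc_tm u \<equiv> Lam lam_ty (Lam app_ty (enc 0 u))"

lemma typing_enc_tm: "scoped 0 u \<Longrightarrow> [] \<turnstile> enc_tm u : Untyped"
  using typing_enc[of 0 u] by (auto simp: uctx_def Untyped_def intro: typing.intros)

text \<open>Applied to \<ell> and a, the weakened term has type \<open>Base\<close> in world 0, so
  the predicate gives an encoding. Abstracting the two variables again and contracting by eta
  recovers \<open>t\<close>.\<close>

lemma beta_eta_enc_tm:
  assumes "[] \<turnstile> t : Untyped"
  shows "\<exists>u. scoped 0 u \<and> [] \<turnstile> t \<approx> enc_tm u : Untyped"
proof -
  let ?t = "rename (\<lambda>i. Suc (Suc i)) t"
  \<comment> \<open>As \<open>t\<close> is closed, any substitution would do; the shift by 2 is the
    weakening that two eta expansions produce.\<close>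
  have "encodable Untyped 0 (subst (\<lambda>i. Var (Suc (Suc i))) t)"
    using assms by (rule encodable_subst) simp
  then have "encodable (lam_ty \<rightarrow>\<^sub>t app_ty \<rightarrow>\<^sub>t Base) 0 ?t"
    by (simp only: subst_Var_comp Untyped_def)
  \<comment> \<open>In \<open>uctx 0\<close>, \<open>Var 1\<close> is \<ell> and
    \<open>Var 0\<close> is a.\<close>
  then have "encodable (app_ty \<rightarrow>\<^sub>t Base) (0 + 0) (App (rename ((+) 0) ?t) (Var 1))"
    using encodable_lam_var[of 0] unfolding encodable.simps(2)[of lam_ty] One_nat_def by (metis add_0)
  then have "encodable Base (0 + 0) (App (rename ((+) 0) (App (rename ((+) 0) ?t) (Var 1))) (Var 0))"
    using encodable_app_var[of 0] unfolding encodable.simps(2)[of app_ty] by (metis add_0)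
  then obtain u where u: "scoped 0 u"
    and eq: "[app_ty, lam_ty] \<turnstile> App (App ?t (Var 1)) (Var 0) \<approx> enc 0 u : Base"
    by (auto simp: rename_plus_0 uctx_def)
  have ty: "[] \<turnstile> t : lam_ty \<rightarrow>\<^sub>t app_ty \<rightarrow>\<^sub>t Base" using assms by (simp add: Untyped_def)
  have "[lam_ty] \<turnstile> App (rename Suc t) (Var 0) : app_ty \<rightarrow>\<^sub>t Base"
    using typing_rename_Suc[OF ty] by (auto intro!: typing.intros(3)[of _ _ lam_ty] typing_Var)
  from beta_eta.eta_Fun[OF this]
  have "[lam_ty] \<turnstile> Lam app_ty (App (App ?t (Var 1)) (Var 0)) \<approx> App (rename Suc t) (Var 0) : app_ty \<rightarrow>\<^sub>t Base"
    by (simp add: rename_rename)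
  then have "[lam_ty] \<turnstile> App (rename Suc t) (Var 0) \<approx> Lam app_ty (enc 0 u) : app_ty \<rightarrow>\<^sub>t Base"
    using beta_eta.cong_Lam[OF eq] by (blast intro: beta_eta.sym beta_eta.trans)
  from beta_eta.trans[OF beta_eta.sym[OF beta_eta.eta_Fun[OF ty]] beta_eta.cong_Lam[OF this]]
  show ?thesis using u by (auto simp: Untyped_def)
qed

lemma equiv_beta_eta_rel: "equiv {t. [] \<turnstile> t : A} (beta_eta_rel A)"
  by (rule equivI)
    (auto simp: beta_eta_rel_def refl_on_def sym_def trans_def dest: beta_eta_typing
      intro: beta_eta.intros)

lemma encode_in_Tm: "scoped 0 u \<Longrightarrow> encode u \<in> Tm Untyped"
  unfolding encode_def Tm_def by (rule quotientI) (simp add: typing_enc_tm)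

lemma Tm_Untyped_eq: "Tm Untyped = encode ` {u. scoped 0 u}"
proof (intro equalityI subsetI)
  fix c assume "c \<in> Tm Untyped"
  then obtain t where t: "[] \<turnstile> t : Untyped" "c = beta_eta_rel Untyped `` {t}"
    unfolding Tm_def by (auto elim: quotientE)
  then obtain u where u: "scoped 0 u" "[] \<turnstile> t \<approx> enc_tm u : Untyped"
    using beta_eta_enc_tm by blast
  then have "c = encode u"
    unfolding t(2) encode_def
    by (intro equiv_class_eq[OF equiv_beta_eta_rel]) (simp add: beta_eta_rel_def)
  with u show "c \<in> encode ` {u. scoped 0 u}" by blast
qed (auto intro: encode_in_Tm)

section \<open>Soundness of the interpretation\<close>

lemma finite_den: "finite Q \<Longrightarrow> finite (den Q A)"
proof (induction A)
  case (Prod A B)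
  have "den Q (A \<times>\<^sub>t B) = (\<lambda>(x, y). VPair x y) ` (den Q A \<times> den Q B)" by auto
  then show ?case using Prod by simp
qed (auto intro: finite_PiE)

text \<open>Finiteness of \<open>D\<close> makes the graph finite, as
  \<open>Abs_fset_inverse\<close> requires.\<close>

lemma vapp_vgraph: "finite D \<Longrightarrow> x \<in> D \<Longrightarrow> vapp (vgraph D f) x = f x"
  by (auto simp: vgraph_def Abs_fset_inverse)

lemma vgraph_cong: "(\<And>x. x \<in> D \<Longrightarrow> f x = g x) \<Longrightarrow> vgraph D f = vgraph D g"
  unfolding vgraph_def by (metis (no_types, lifting) image_cong)

text \<open>\<open>den\<close> uses extensional functions, whereas \<open>sem\<close> forms graphs
  of arbitrary ones. A graph sees only the values on its domain, so \<open>f\<close> may be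
  restricted first.\<close>

lemma vgraph_in_den:
  assumes "\<And>x. x \<in> den Q A \<Longrightarrow> f x \<in> den Q B"
  shows "vgraph (den Q A) f \<in> den Q (A \<rightarrow>\<^sub>t B)"
proof -
  have "vgraph (den Q A) f = vgraph (den Q A) (restrict f (den Q A))"
    by (rule vgraph_cong) simp
  then show ?thesis using assms by auto
qed

lemma vapp_in_den:
  "finite Q \<Longrightarrow> g \<in> den Q (A \<rightarrow>\<^sub>t B) \<Longrightarrow> x \<in> den Q A \<Longrightarrow> vapp g x \<in> den Q B"
  by (auto simp: vapp_vgraph finite_den)

text \<open>The semantic counterpart of eta for functions, used in \<open>sem_sound\<close>.\<close>

lemma vgraph_vapp: "finite Q \<Longrightarrow> g \<in> den Q (A \<rightarrow>\<^sub>t B) \<Longrightarrow> vgraph (den Q A) (vapp g) = g"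
  by (auto simp: vapp_vgraph finite_den intro: vgraph_cong)

text \<open>The equation is demanded at every index, even past the end of the lists, so that
  \<open>t\<close> may be arbitrary. For \<open>Suc\<close> and \<open>x # \<rho>\<close> it holds
  by computation of \<open>!\<close>.\<close>

lemma sem_rename: "(\<And>i. \<rho>' ! r i = \<rho> ! i) \<Longrightarrow> sem Q (rename r t) \<rho>' = sem Q t \<rho>"
proof (induction t arbitrary: r \<rho> \<rho>')
  case (Lam A t)
  have "sem Q (rename (case_nat 0 (\<lambda>i. Suc (r i))) t) (x # \<rho>') = sem Q t (x # \<rho>)" for x
    by (rule Lam.IH) (use Lam.prems in \<open>auto split: nat.split\<close>)
  then show ?case by simp
next
  case (App t s)
  then show ?case unfolding rename.simps sem.simps by metis
next
  case (Tuple t s)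
  then show ?case unfolding rename.simps sem.simps by metis
next
  case (Proj1 t)
  then show ?case unfolding rename.simps sem.simps by metis
next
  case (Proj2 t)
  then show ?case unfolding rename.simps sem.simps by metis
qed auto

lemma sem_subst: "(\<And>i. sem Q (\<sigma> i) \<rho>' = \<rho> ! i) \<Longrightarrow> sem Q (subst \<sigma> t) \<rho>' = sem Q t \<rho>"
proof (induction t arbitrary: \<sigma> \<rho> \<rho>')
  case (Lam A t)
  have "sem Q (subst (case_nat (Var 0) (\<lambda>i. rename Suc (\<sigma> i))) t) (x # \<rho>') = sem Q t (x # \<rho>)" for x
  proof (rule Lam.IH)
    fix i
    have "sem Q (rename Suc (\<sigma> j)) (x # \<rho>') = sem Q (\<sigma> j) \<rho>'" for j
      by (rule sem_rename) simp
    then show "sem Q (case_nat (Var 0) (\<lambda>i. rename Suc (\<sigma> i)) i) (x # \<rho>') = (x # \<rho>) ! i"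
      using Lam.prems by (auto split: nat.split)
  qed
  then show ?case by simp
next
  case (App t s)
  then show ?case unfolding subst.simps sem.simps by metis
next
  case (Tuple t s)
  then show ?case unfolding subst.simps sem.simps by metis
next
  case (Proj1 t)
  then show ?case unfolding subst.simps sem.simps by metis
next
  case (Proj2 t)
  then show ?case unfolding subst.simps sem.simps by metis
qed auto

definition env_in :: "'q set \<Rightarrow> ty list \<Rightarrow> 'q val list \<Rightarrow> bool" where
  "env_in Q \<Gamma> \<rho> \<longleftrightarrow> list_all2 (\<lambda>A x. x \<in> den Q A) \<Gamma> \<rho>"

lemma env_in_Nil: "env_in Q [] []"
  by (simp add: env_in_def)

lemma env_in_Cons: "env_in Q \<Gamma> \<rho> \<Longrightarrow> x \<in> den Q A \<Longrightarrow> env_in Q (A # \<Gamma>) (x # \<rho>)"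
  by (simp add: env_in_def)

lemma sem_in_den:
  assumes "finite Q"
  shows "\<Gamma> \<turnstile> t : A \<Longrightarrow> env_in Q \<Gamma> \<rho> \<Longrightarrow> sem Q t \<rho> \<in> den Q A"
proof (induction arbitrary: \<rho> rule: typing.induct)
  case (1 i \<Gamma>)
  then show ?case by (auto simp: env_in_def list_all2_conv_all_nth)
next
  case (2 A \<Gamma> t B)
  show ?case unfolding sem.simps
    by (rule vgraph_in_den) (use 2 in \<open>blast intro: env_in_Cons\<close>)
next
  case (3 \<Gamma> t A B s)
  show ?case unfolding sem.simps
    by (rule vapp_in_den[OF assms]) (use 3 in blast)+
next
  case (5 \<Gamma> t A B)
  from "5.IH"[OF "5.prems"] show ?case by auto
next
  case (6 \<Gamma> t A B)
  from "6.IH"[OF "6.prems"] show ?case by auto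
qed auto

text \<open>Beta needs the argument in the domain of the graph, and the eta rules need the value to
  be a graph, a pair or \<open>VStar\<close>; \<open>sem_in_den\<close> supplies all of
  this.\<close>

lemma sem_sound:
  assumes "finite Q"
  shows "\<Gamma> \<turnstile> s \<approx> t : A \<Longrightarrow> env_in Q \<Gamma> \<rho> \<Longrightarrow> sem Q s \<rho> = sem Q t \<rho>"
proof (induction arbitrary: \<rho> rule: beta_eta.induct)
  case (cong_Lam A \<Gamma> t t' B)
  then show ?case by (auto intro!: vgraph_cong env_in_Cons)
next
  case (beta_Fun A \<Gamma> t B s)
  have "sem Q (subst (case_nat s Var) t) \<rho> = sem Q t (sem Q s \<rho> # \<rho>)"
    by (rule sem_subst) (auto split: nat.split)
  then show ?case
    using sem_in_den[OF assms beta_Fun(2,3)] by (simp add: vapp_vgraph finite_den assms)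
next
  case (eta_Fun \<Gamma> t A B)
  have "sem Q (rename Suc t) (x # \<rho>) = sem Q t \<rho>" for x
    by (rule sem_rename) simp
  then show ?case
    using vgraph_vapp[OF assms sem_in_den[OF assms eta_Fun]] by simp
next
  case (eta_Prod \<Gamma> t A B)
  from sem_in_den[OF assms this] show ?case by auto
next
  case (eta_One \<Gamma> t)
  from sem_in_den[OF assms this] show ?case by auto
next
  case (trans \<Gamma> s t A u)
  then show ?case by metis
qed auto

text \<open>By soundness the image of the class is a singleton, so \<open>the_elem\<close> returns
  its element.\<close>

lemma sem_class_encode:
  assumes "finite Q" and "scoped 0 u"
  shows "sem_class Q (encode u) = sem Q (enc_tm u) []"
proof -
  have "sem Q t [] = sem Q (enc_tm u) []" if "t \<in> encode u" for t
    using that sem_sound[OF assms(1) _ env_in_Nil, of "enc_tm u" t Untyped]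
    by (auto simp: encode_def beta_eta_rel_def)
  moreover have "enc_tm u \<in> encode u"
    using typing_enc_tm[OF assms(2)] by (auto simp: encode_def beta_eta_rel_def intro: beta_eta.refl)
  ultimately have "(\<lambda>t. sem Q t []) ` encode u = {sem Q (enc_tm u) []}" by auto
  then show ?thesis by (simp add: sem_class_def)
qed

section \<open>The recognizer\<close>

text \<open>The value of the encoding in the model, computed on the untyped term itself (see
  \<open>sem_enc_eq_cap_eval\<close>), so that the counting argument can be carried out without
  \<open>val\<close>.\<close>

primrec cap_eval :: "nat list \<Rightarrow> utm \<Rightarrow> nat" where
  "cap_eval e (Idx i) = e ! (i - 1)"
| "cap_eval e (Abs u) = (if cap_eval (0 # e) u = 0 then (if cap_eval (1 # e) u = 2 then 2 else 0)
     else cap_eval (0 # e) u)"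
| "cap_eval e (Ap u v) = min 2 (cap_eval e u + cap_eval e v)"

text \<open>With entries 0 and 1, this is the uncapped number of occurrences of the marked free
  variables.\<close>

primrec weight :: "nat list \<Rightarrow> utm \<Rightarrow> nat" where
  "weight e (Idx i) = e ! (i - 1)"
| "weight e (Abs u) = weight (0 # e) u"
| "weight e (Ap u v) = weight e u + weight e v"

text \<open>The prefix \<open>d\<close> lets the induction pass below binders, each of which
  prepends a 0; the uses take \<open>d = []\<close>. The marked variable has index
  \<open>Suc (length d)\<close> because indices start at 1.\<close>

lemma weight_mark:
  "scoped n u \<Longrightarrow> n = length d + Suc (length e) \<Longrightarrow>
    weight (d @ 1 # e) u = weight (d @ 0 # e) u + occ (Suc (length d)) u"
proof (induction arbitrary: d rule: scoped.induct)
  case (1 i n)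
  then show ?case by (auto simp: nth_append nth_Cons split: nat.split)
next
  case (2 n u)
  from "2.IH"[of "0 # d"] "2.prems" show ?case by simp
qed auto

lemma weight_zero: "scoped n u \<Longrightarrow> weight (replicate n 0) u = 0"
  by (induction rule: scoped.induct) auto

text \<open>For an abstraction, a positive weight of the body at 0 is passed on. Otherwise the probe
  with 1 gives the capped number of occurrences of the bound variable, which affineness keeps below
  2, so the result is 0 and agrees with the weight.\<close>

lemma cap_eval_affine:
  "scoped n u \<Longrightarrow> affine u \<Longrightarrow> length e = n \<Longrightarrow> set e \<subseteq> {0, 1} \<Longrightarrow>
    cap_eval e u = min 2 (weight e u)"
proof (induction arbitrary: e rule: scoped.induct)
  case (1 i n)
  then have "e ! (i - 1) \<in> {0, 1}" using nth_mem[of "i - 1" e] by fastforce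
  then show ?case by auto
next
  case (2 n u)
  have "cap_eval (0 # e) u = min 2 (weight (0 # e) u)" "cap_eval (1 # e) u = min 2 (weight (1 # e) u)"
    using 2 by auto
  moreover have "weight (1 # e) u = weight (0 # e) u + occ 1 u"
    using weight_mark[OF 2(1), of "[]" e] "2.prems" by simp
  ultimately show ?case using "2.prems" by auto
qed auto

text \<open>If the body of an abstraction is not affine, its value 2 is passed on. Otherwise the
  probe with 0 gives 0, and the probe with 1, being the capped count of the bound variable, gives 2
  exactly if that variable occurs at least twice.\<close>

lemma cap_eval_replicate_zero:
  "scoped n u \<Longrightarrow> cap_eval (replicate n 0) u = (if affine u then 0 else 2)"
proof (induction rule: scoped.induct)
  case (2 n u)
  have "set (1 # replicate n 0) \<subseteq> {0, 1 :: nat}" by auto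
  then have "cap_eval (1 # replicate n 0) u = min 2 (occ 1 u)" if "affine u"
    using cap_eval_affine[OF 2(1) that, of "1 # replicate n 0"]
      weight_mark[OF 2(1), of "[]" "replicate n 0"] weight_zero[OF 2(1)] by auto
  with 2 show ?case by auto
qed auto

lemma cap_eval_in_cap_set:
  "scoped n u \<Longrightarrow> length e = n \<Longrightarrow> set e \<subseteq> {0, 1, 2} \<Longrightarrow> cap_eval e u \<in> {0, 1, 2}"
proof (induction arbitrary: e rule: scoped.induct)
  case (1 i n)
  then have "e ! (i - 1) \<in> {0, 1, 2}" using nth_mem[of "i - 1" e] by fastforce
  then show ?case by simp
next
  case (2 n u)
  from "2.IH"[of "0 # e"] "2.prems" show ?case by auto
qed auto

section \<open>The finite model realizing \<open>cap_eval\<close>\<close>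

abbreviation cap_set :: "nat set" where
  "cap_set \<equiv> {0, 1, 2}"

fun vnat :: "nat val \<Rightarrow> nat" where
  "vnat (VBase n) = n"
| "vnat _ = 0"

definition cap_lam :: "nat val" where
  "cap_lam = vgraph (den cap_set (Base \<rightarrow>\<^sub>t Base))
     (\<lambda>f. if vapp f (VBase 0) = VBase 0
        then (if vapp f (VBase 1) = VBase 2 then VBase 2 else VBase 0) else vapp f (VBase 0))"

definition cap_app :: "nat val" where
  "cap_app = vgraph (den cap_set Base) (\<lambda>x. vgraph (den cap_set Base)
     (\<lambda>y. VBase (min 2 (vnat x + vnat y))))"

lemma cap_lam_in_den: "cap_lam \<in> den cap_set lam_ty"
  unfolding cap_lam_def
proof (rule vgraph_in_den)
  fix f assume "f \<in> den cap_set (Base \<rightarrow>\<^sub>t Base)"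
  then have "vapp f (VBase 0) \<in> den cap_set Base" by (rule vapp_in_den[rotated]) auto
  then show "(if vapp f (VBase 0) = VBase 0
      then (if vapp f (VBase 1) = VBase 2 then VBase 2 else VBase 0) else vapp f (VBase 0))
    \<in> den cap_set Base"
    by auto
qed

lemma cap_app_in_den: "cap_app \<in> den cap_set app_ty"
  unfolding cap_app_def by (intro vgraph_in_den) auto

text \<open>The entries of \<open>e\<close> range over all of \<open>cap_set\<close>, including 2,
  because the argument of \<ell> is a function on the whole set.\<close>

lemma sem_enc_eq_cap_eval:
  "scoped n u \<Longrightarrow> length e = n \<Longrightarrow> set e \<subseteq> cap_set \<Longrightarrow>
    sem cap_set (enc n u) (map VBase e @ [cap_app, cap_lam]) = VBase (cap_eval e u)"
proof (induction arbitrary: e rule: scoped.induct)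
  case (1 i n)
  then show ?case by (auto simp: nth_append)
next
  case (2 n u)
  let ?\<rho> = "map VBase e @ [cap_app, cap_lam]"
  let ?g = "\<lambda>x. sem cap_set (enc (n + 1) u) (x # ?\<rho>)"
  let ?f = "vgraph (den cap_set Base) ?g"
  have g: "?g (VBase q) = VBase (cap_eval (q # e) u)" if "q \<in> cap_set" for q
    using "2.IH"[of "q # e"] "2.prems" that by simp
  \<comment> \<open>\<open>cap_lam\<close> is a graph, so it can be evaluated only at members of its
    domain.\<close>
  have "?f \<in> den cap_set (Base \<rightarrow>\<^sub>t Base)"
  proof (rule vgraph_in_den)
    fix x assume "x \<in> den cap_set Base"
    then obtain q where q: "x = VBase q" "q \<in> cap_set" by auto
    then show "?g x \<in> den cap_set Base"
      using g[OF q(2)] cap_eval_in_cap_set[OF 2(1), of "q # e"] "2.prems" by auto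
  qed
  moreover have "vapp ?f (VBase q) = VBase (cap_eval (q # e) u)" if "q \<in> cap_set" for q
    using that g by (subst vapp_vgraph) auto
  ultimately have "vapp cap_lam ?f = VBase (cap_eval e (Abs u))"
    unfolding cap_lam_def by (subst vapp_vgraph) (auto simp: finite_den simp del: den.simps)
  moreover have "?\<rho> ! (n + 1) = cap_lam" using 2 by (simp add: nth_append)
  ultimately show ?case by simp
next
  case (3 n u v)
  have "cap_eval e u \<in> cap_set" "cap_eval e v \<in> cap_set"
    using cap_eval_in_cap_set 3 by blast+
  then have "vapp (vapp cap_app (VBase (cap_eval e u))) (VBase (cap_eval e v))
      = VBase (cap_eval e (Ap u v))"
    unfolding cap_app_def by (subst vapp_vgraph, simp, simp)+ simp
  moreover have "(map VBase e @ [cap_app, cap_lam]) ! n = cap_app"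
    using 3 by (simp add: nth_append)
  ultimately show ?case using 3 by simp
qed

lemma vapp_sem_enc_tm:
  assumes "scoped 0 u"
  shows "vapp (vapp (sem cap_set (enc_tm u) []) cap_lam) cap_app = VBase (cap_eval [] u)"
  using sem_enc_eq_cap_eval[OF assms, of "[]"] cap_lam_in_den cap_app_in_den
  by (simp add: vapp_vgraph finite_den del: den.simps One_nat_def)

theorem theoremA10:
  "FinSet_recognizable Untyped {t \<in> Tm Untyped. affine (untyped_of t)}"
proof -
  define F where "F = {x \<in> den cap_set Untyped. vapp (vapp x cap_lam) cap_app = VBase 0}"
  \<comment> \<open>The tested value is \<open>cap_eval [] u\<close> by
    \<open>vapp_sem_enc_tm\<close>, and the case \<open>n = 0\<close> of
    \<open>cap_eval_replicate_zero\<close> says when it is 0.\<close>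
  have rec: "sem_class cap_set (encode u) \<in> F \<longleftrightarrow> affine u" if "scoped 0 u" for u
    using that cap_eval_replicate_zero[OF that]
      sem_in_den[OF _ typing_enc_tm[OF that] env_in_Nil, of cap_set]
    by (simp add: F_def sem_class_encode vapp_sem_enc_tm del: sem.simps den.simps One_nat_def)
  have "affine (untyped_of t) \<longleftrightarrow> sem_class cap_set t \<in> F" if "t \<in> Tm Untyped" for t
  proof -
    \<comment> \<open>Surjectivity of \<open>encode\<close> makes \<open>untyped_of\<close> a right
      inverse of it on \<open>Tm Untyped\<close>.\<close>
    have "t \<in> encode ` {u. scoped 0 u}" using that by (simp add: Tm_Untyped_eq)
    then have "untyped_of t \<in> {u. scoped 0 u}" and eq: "encode (untyped_of t) = t"
      unfolding untyped_of_def by (rule inv_into_into, rule f_inv_into_f)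
    then show ?thesis using rec[of "untyped_of t"] by (simp only: eq mem_Collect_eq)
  qed
  then have "{t \<in> Tm Untyped. affine (untyped_of t)} = {t \<in> Tm Untyped. sem_class cap_set t \<in> F}"
    by blast
  moreover have "F \<subseteq> den cap_set Untyped" by (auto simp: F_def)
  ultimately show ?thesis
    unfolding FinSet_recognizable_def by (intro exI[of _ cap_set] exI[of _ F]) simp
qed

end
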